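(* Let $R$ be a commutative ring, let $M$ be a $C4$-module over $R$, and let $\mathfrak p\in\operatorname{Spec} R$. Assume that $M$ satisfies decomposition lifting at $\mathfrak p$ and morphism lifting at $\mathfrak p$. Then $M_{\mathfrak p}$ is a $C4$-module (over $R_{\mathfrak p}$).
   Context: Rings are commutative with identity and modules are unital. A module $M$ over a commutative ring is called a $C4$-module if for every decomposition $M=A\oplus B$ and every homomorphism $f:A\to B$, the image $\operatorname{Im}(f)$ is isomorphic to a direct summand of $B$. For a prime $\mathfrak p$ and a submodule $N\le M$, $N_{\mathfrak p}$ is viewed as an $R_{\mathfrak p}$-submodule of $M_{\mathfrak p}$. $M$ satisfies decomposition lifting at $\mathfrak p$ if for every decomposition $M_{\mathfrak p}=U\oplus V$ there exist submodules $A,B\le M$ with $M=A\oplus B$, $U=A_{\mathfrak p}$ and $V=B_{\mathfrak p}$. $M$ satisfies morphism lifting at $\mathfrak p$ if whenever $M=A\oplus B$ is a decomposition of $M$, every $R_{\mathfrak p}$-homomorphism $g:A_{\mathfrak p}\to B_{\mathfrak p}$ is of the form $g=f_{\mathfrak p}$ for some $R$-homomorphism $f:A\to B$. *)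

theory Defs
  imports "HOL-Algebra.Module" "HOL-Algebra.Ideal"
begin

section \<open>Modules, direct sum decompositions, C4-modules\<close>

definition module_hom ::
    "('r, 'c) ring_scheme \<Rightarrow> ('r, 'm, 'd) module_scheme \<Rightarrow> ('r, 'n, 'e) module_scheme \<Rightarrow> ('m \<Rightarrow> 'n) set"
  where "module_hom R M N =
    {f \<in> carrier M \<rightarrow> carrier N.
       (\<forall>x\<in>carrier M. \<forall>y\<in>carrier M. f (x \<oplus>\<^bsub>M\<^esub> y) = f x \<oplus>\<^bsub>N\<^esub> f y) \<and>
       (\<forall>r\<in>carrier R. \<forall>x\<in>carrier M. f (r \<odot>\<^bsub>M\<^esub> x) = r \<odot>\<^bsub>N\<^esub> f x)}"

definition module_isomorphic ::
    "('r, 'c) ring_scheme \<Rightarrow> ('r, 'm, 'd) module_scheme \<Rightarrow> ('r, 'n, 'e) module_scheme \<Rightarrow> bool"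
  where "module_isomorphic R M N \<longleftrightarrow>
    (\<exists>f \<in> module_hom R M N. bij_betw f (carrier M) (carrier N))"

abbreviation restrict_module :: "('r, 'm, 'd) module_scheme \<Rightarrow> 'm set \<Rightarrow> ('r, 'm, 'd) module_scheme"
  where "restrict_module M N \<equiv> M\<lparr>carrier := N\<rparr>"

definition direct_decomposition ::
    "('r, 'c) ring_scheme \<Rightarrow> ('r, 'm, 'd) module_scheme \<Rightarrow> 'm set \<Rightarrow> 'm set \<Rightarrow> bool"
  where "direct_decomposition R M A B \<longleftrightarrow>
    submodule A R M \<and> submodule B R M \<and>
    A <+>\<^bsub>M\<^esub> B = carrier M \<and> A \<inter> B = {\<zero>\<^bsub>M\<^esub>}"

definition direct_summand ::
    "('r, 'c) ring_scheme \<Rightarrow> ('r, 'm, 'd) module_scheme \<Rightarrow> 'm set \<Rightarrow> bool"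
  where "direct_summand R M A \<longleftrightarrow> (\<exists>B. direct_decomposition R M A B)"

definition C4_module :: "('r, 'c) ring_scheme \<Rightarrow> ('r, 'm, 'd) module_scheme \<Rightarrow> bool"
  where "C4_module R M \<longleftrightarrow> module R M \<and>
    (\<forall>A B f. direct_decomposition R M A B \<longrightarrow>
       f \<in> module_hom R (restrict_module M A) (restrict_module M B) \<longrightarrow>
       (\<exists>D. direct_summand R (restrict_module M B) D \<and>
            module_isomorphic R (restrict_module M (f ` A)) (restrict_module M D)))"


section \<open>Localization at a prime ideal\<close>

definition localization_rel ::
    "('r, 'c) ring_scheme \<Rightarrow> 'r set \<Rightarrow> ('r, 'm, 'd) module_scheme \<Rightarrow> (('m \<times> 'r) \<times> ('m \<times> 'r)) set"
  where "localization_rel R p M =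
    {((m, s), (n, t)). m \<in> carrier M \<and> n \<in> carrier M \<and> s \<in> carrier R - p \<and> t \<in> carrier R - p \<and>
       (\<exists>u \<in> carrier R - p. u \<odot>\<^bsub>M\<^esub> (t \<odot>\<^bsub>M\<^esub> m) = u \<odot>\<^bsub>M\<^esub> (s \<odot>\<^bsub>M\<^esub> n))}"

definition fraction ::
    "('r, 'c) ring_scheme \<Rightarrow> 'r set \<Rightarrow> ('r, 'm, 'd) module_scheme \<Rightarrow> 'm \<Rightarrow> 'r \<Rightarrow> ('m \<times> 'r) set"
  where "fraction R p M m s = localization_rel R p M `` {(m, s)}"

definition regular_module :: "('r, 'c) ring_scheme \<Rightarrow> ('r, 'r) module"
  where "regular_module R =
    \<lparr>carrier = carrier R, mult = mult R, one = one R, zero = zero R, add = add R, smult = mult R\<rparr>"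

text \<open>In the next two definitions an operation on equivalence classes is given by the union over all
  representatives; all members of the union agree, see \<open>localize_ring_simps\<close> and
  \<open>localize_module_simps\<close> below.\<close>

definition localize_ring :: "('r, 'c) ring_scheme \<Rightarrow> 'r set \<Rightarrow> ('r \<times> 'r) set ring"
  where "localize_ring R p =
    (let frac = fraction R p (regular_module R) in
     \<lparr>carrier = (carrier R \<times> (carrier R - p)) // localization_rel R p (regular_module R),
      mult = (\<lambda>X Y. \<Union>(a, s)\<in>X. \<Union>(b, t)\<in>Y. frac (a \<otimes>\<^bsub>R\<^esub> b) (s \<otimes>\<^bsub>R\<^esub> t)),
      one = frac \<one>\<^bsub>R\<^esub> \<one>\<^bsub>R\<^esub>,
      zero = frac \<zero>\<^bsub>R\<^esub> \<one>\<^bsub>R\<^esub>,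
      add = (\<lambda>X Y. \<Union>(a, s)\<in>X. \<Union>(b, t)\<in>Y.
               frac ((t \<otimes>\<^bsub>R\<^esub> a) \<oplus>\<^bsub>R\<^esub> (s \<otimes>\<^bsub>R\<^esub> b)) (s \<otimes>\<^bsub>R\<^esub> t))\<rparr>)"

text \<open>The record type of modules extends that of rings; the fields \<open>mult\<close> and \<open>one\<close> play no
  role in a module.\<close>

definition localize_module ::
    "('r, 'c) ring_scheme \<Rightarrow> 'r set \<Rightarrow> ('r, 'm, 'd) module_scheme \<Rightarrow> (('r \<times> 'r) set, ('m \<times> 'r) set) module"
  where "localize_module R p M =
    (let frac = fraction R p M in
     \<lparr>carrier = (carrier M \<times> (carrier R - p)) // localization_rel R p M,
      mult = undefined,
      one = undefined,
      zero = frac \<zero>\<^bsub>M\<^esub> \<one>\<^bsub>R\<^esub>,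
      add = (\<lambda>X Y. \<Union>(m, s)\<in>X. \<Union>(n, t)\<in>Y.
               frac ((t \<odot>\<^bsub>M\<^esub> m) \<oplus>\<^bsub>M\<^esub> (s \<odot>\<^bsub>M\<^esub> n)) (s \<otimes>\<^bsub>R\<^esub> t)),
      smult = (\<lambda>X Y. \<Union>(a, s)\<in>X. \<Union>(m, t)\<in>Y. frac (a \<odot>\<^bsub>M\<^esub> m) (s \<otimes>\<^bsub>R\<^esub> t))\<rparr>)"

text \<open>The localization of a submodule \<open>N\<close> of \<open>M\<close>, viewed inside the localization of \<open>M\<close>.\<close>

definition localize_submodule ::
    "('r, 'c) ring_scheme \<Rightarrow> 'r set \<Rightarrow> ('r, 'm, 'd) module_scheme \<Rightarrow> 'm set \<Rightarrow> ('m \<times> 'r) set set"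
  where "localize_submodule R p M N = {fraction R p M n s | n s. n \<in> N \<and> s \<in> carrier R - p}"

text \<open>For submodules \<open>A\<close> and \<open>B\<close> of \<open>M\<close> and \<open>f\<close> a homomorphism from \<open>A\<close> to \<open>B\<close>, the localized map
  sends \<open>a/s\<close> to \<open>f a/s\<close>.  Its arguments are classes of pairs over \<open>M\<close>, so only the
  representatives with numerator in \<open>A\<close> are used; see \<open>localize_hom_fraction\<close> below.\<close>

definition localize_hom ::
    "('r, 'c) ring_scheme \<Rightarrow> 'r set \<Rightarrow> ('r, 'm, 'd) module_scheme \<Rightarrow> 'm set \<Rightarrow> ('m \<Rightarrow> 'm) \<Rightarrow>
     ('m \<times> 'r) set \<Rightarrow> ('m \<times> 'r) set"
  where "localize_hom R p M A f X = (\<Union>(a, s) \<in> X \<inter> (A \<times> UNIV). fraction R p M (f a) s)"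

definition decomposition_lifting ::
    "('r, 'c) ring_scheme \<Rightarrow> 'r set \<Rightarrow> ('r, 'm, 'd) module_scheme \<Rightarrow> bool"
  where "decomposition_lifting R p M \<longleftrightarrow>
    (\<forall>U V. direct_decomposition (localize_ring R p) (localize_module R p M) U V \<longrightarrow>
       (\<exists>A B. direct_decomposition R M A B \<and>
              U = localize_submodule R p M A \<and> V = localize_submodule R p M B))"

definition morphism_lifting ::
    "('r, 'c) ring_scheme \<Rightarrow> 'r set \<Rightarrow> ('r, 'm, 'd) module_scheme \<Rightarrow> bool"
  where "morphism_lifting R p M \<longleftrightarrow>
    (\<forall>A B g. direct_decomposition R M A B \<longrightarrow>
       g \<in> module_hom (localize_ring R p)
             (restrict_module (localize_module R p M) (localize_submodule R p M A))
             (restrict_module (localize_module R p M) (localize_submodule R p M B)) \<longrightarrow>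
       (\<exists>f \<in> module_hom R (restrict_module M A) (restrict_module M B).
          \<forall>X \<in> localize_submodule R p M A. g X = localize_hom R p M A f X))"


section \<open>The localizations are well defined\<close>

lemma regular_module_simps [simp]:
  "carrier (regular_module R) = carrier R" "mult (regular_module R) = mult R"
  "one (regular_module R) = one R" "zero (regular_module R) = zero R"
  "add (regular_module R) = add R" "smult (regular_module R) = mult R"
  by (simp_all add: regular_module_def)

lemma (in cring) regular_module: "module R (regular_module R)"
proof (rule moduleI)
  show "abelian_group (regular_module R)"
    by (rule abelian_groupI) (auto simp: a_ac intro: l_neg)
qed (auto simp: l_distr r_distr m_assoc is_cring)

locale localization = module R M + primeideal p R for R (structure) and M (structure) and p
begin

abbreviation "S \<equiv> carrier R - p"
abbreviation "frac \<equiv> fraction R p M"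

lemma one_S: "\<one> \<in> S"
  by (metis DiffI I_notcarr R.one_closed one_imp_carrier)

lemma mult_S: "s \<in> S \<Longrightarrow> t \<in> S \<Longrightarrow> s \<otimes> t \<in> S"
  using I_prime by blast

lemma smult_commute:
  "a \<in> carrier R \<Longrightarrow> b \<in> carrier R \<Longrightarrow> x \<in> carrier M \<Longrightarrow>
   a \<odot>\<^bsub>M\<^esub> (b \<odot>\<^bsub>M\<^esub> x) = b \<odot>\<^bsub>M\<^esub> (a \<odot>\<^bsub>M\<^esub> x)"
  by (metis R.m_comm smult_assoc1)

lemma equiv_localization: "equiv (carrier M \<times> S) (localization_rel R p M)"
proof (rule equivI)
  show "localization_rel R p M \<subseteq> (carrier M \<times> S) \<times> (carrier M \<times> S)"
    by (auto simp: localization_rel_def)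
  show "refl_on (carrier M \<times> S) (localization_rel R p M)"
    using one_S by (auto simp: refl_on_def localization_rel_def)
  show "sym (localization_rel R p M)"
    unfolding sym_def localization_rel_def by simp (metis (lifting))
  show "trans (localization_rel R p M)"
  proof (rule transI, clarify)
    fix m s n t k w
    assume 1: "((m, s), (n, t)) \<in> localization_rel R p M"
       and 2: "((n, t), (k, w)) \<in> localization_rel R p M"
    from 1 obtain u where mem: "m \<in> carrier M" "n \<in> carrier M" "s \<in> S" "t \<in> S"
      and u: "u \<in> S" "u \<odot>\<^bsub>M\<^esub> (t \<odot>\<^bsub>M\<^esub> m) = u \<odot>\<^bsub>M\<^esub> (s \<odot>\<^bsub>M\<^esub> n)"
      by (auto simp: localization_rel_def)
    from 2 obtain v where mem2: "k \<in> carrier M" "w \<in> S"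
      and v: "v \<in> S" "v \<odot>\<^bsub>M\<^esub> (w \<odot>\<^bsub>M\<^esub> n) = v \<odot>\<^bsub>M\<^esub> (t \<odot>\<^bsub>M\<^esub> k)"
      by (auto simp: localization_rel_def)
    have uvt: "u \<otimes> v \<otimes> t \<in> S" using u v mem mult_S by simp
    have c: "u \<in> carrier R" "v \<in> carrier R" "t \<in> carrier R" "w \<in> carrier R" "s \<in> carrier R"
      using u v mem mem2 by auto
    have "(u \<otimes> v \<otimes> t) \<odot>\<^bsub>M\<^esub> (w \<odot>\<^bsub>M\<^esub> m) = v \<odot>\<^bsub>M\<^esub> (w \<odot>\<^bsub>M\<^esub> (u \<odot>\<^bsub>M\<^esub> (t \<odot>\<^bsub>M\<^esub> m)))"
      using c mem by (simp add: smult_assoc1[symmetric] R.m_ac)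
    also have "\<dots> = u \<odot>\<^bsub>M\<^esub> (s \<odot>\<^bsub>M\<^esub> (v \<odot>\<^bsub>M\<^esub> (w \<odot>\<^bsub>M\<^esub> n)))"
      unfolding u using c mem by (simp add: smult_assoc1[symmetric] R.m_ac)
    also have "\<dots> = (u \<otimes> v \<otimes> t) \<odot>\<^bsub>M\<^esub> (s \<odot>\<^bsub>M\<^esub> k)"
      unfolding v using c mem2 by (simp add: smult_assoc1[symmetric] R.m_ac)
    finally show "((m, s), (k, w)) \<in> localization_rel R p M"
      using mem mem2 uvt by (auto simp: localization_rel_def)
  qed
qed

lemma fraction_eq_iff:
  assumes "m \<in> carrier M" "n \<in> carrier M" "s \<in> S" "t \<in> S"
  shows "frac m s = frac n t \<longleftrightarrow> (\<exists>u\<in>S. u \<odot>\<^bsub>M\<^esub> (t \<odot>\<^bsub>M\<^esub> m) = u \<odot>\<^bsub>M\<^esub> (s \<odot>\<^bsub>M\<^esub> n))"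
  using eq_equiv_class_iff[OF equiv_localization, of "(m, s)" "(n, t)"] assms
  by (auto simp: fraction_def localization_rel_def)

lemma fraction_eqI:
  assumes "m \<in> carrier M" "n \<in> carrier M" "s \<in> S" "t \<in> S" "t \<odot>\<^bsub>M\<^esub> m = s \<odot>\<^bsub>M\<^esub> n"
  shows "frac m s = frac n t"
  using assms one_S by (auto simp: fraction_eq_iff)

lemma carrier_localize_module:
  "carrier (localize_module R p M) = {frac m s | m s. m \<in> carrier M \<and> s \<in> S}"
  by (auto simp: localize_module_def Let_def quotient_def fraction_def)

lemma UN_fraction:
  assumes "m \<in> carrier M" "s \<in> S"
    and "\<And>n t. n \<in> carrier M \<Longrightarrow> t \<in> S \<Longrightarrow> frac m s = frac n t \<Longrightarrow> F n t = F m s"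
  shows "(\<Union>(n, t)\<in>frac m s. F n t) = F m s"
proof -
  have mem: "(n, t) \<in> frac m s \<Longrightarrow> n \<in> carrier M \<and> t \<in> S \<and> frac m s = frac n t" for n t
    using equiv_class_eq[OF equiv_localization, of "(m, s)" "(n, t)"]
    by (auto simp: fraction_def localization_rel_def)
  moreover have "(m, s) \<in> frac m s"
    using equiv_class_self[OF equiv_localization, of "(m, s)"] assms(1,2) by (simp add: fraction_def)
  ultimately show ?thesis using assms(3) by fast
qed

lemma add_cong:
  assumes "m \<in> carrier M" "s \<in> S" "m' \<in> carrier M" "s' \<in> S" "frac m s = frac m' s'"
    and "n \<in> carrier M" "t \<in> S" "n' \<in> carrier M" "t' \<in> S" "frac n t = frac n' t'"
  shows "frac ((t' \<odot>\<^bsub>M\<^esub> m') \<oplus>\<^bsub>M\<^esub> (s' \<odot>\<^bsub>M\<^esub> n')) (s' \<otimes> t') =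
         frac ((t \<odot>\<^bsub>M\<^esub> m) \<oplus>\<^bsub>M\<^esub> (s \<odot>\<^bsub>M\<^esub> n)) (s \<otimes> t)"
proof -
  obtain u where u: "u \<in> S" "u \<odot>\<^bsub>M\<^esub> (s' \<odot>\<^bsub>M\<^esub> m) = u \<odot>\<^bsub>M\<^esub> (s \<odot>\<^bsub>M\<^esub> m')"
    using assms by (auto simp: fraction_eq_iff)
  obtain v where v: "v \<in> S" "v \<odot>\<^bsub>M\<^esub> (t' \<odot>\<^bsub>M\<^esub> n) = v \<odot>\<^bsub>M\<^esub> (t \<odot>\<^bsub>M\<^esub> n')"
    using assms by (auto simp: fraction_eq_iff)
  have c: "u \<in> carrier R" "v \<in> carrier R" "s \<in> carrier R" "t \<in> carrier R"
    "s' \<in> carrier R" "t' \<in> carrier R" using assms u v by auto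
  have "(u \<otimes> v) \<odot>\<^bsub>M\<^esub> ((s \<otimes> t) \<odot>\<^bsub>M\<^esub> ((t' \<odot>\<^bsub>M\<^esub> m') \<oplus>\<^bsub>M\<^esub> (s' \<odot>\<^bsub>M\<^esub> n')))
      = v \<odot>\<^bsub>M\<^esub> (t \<odot>\<^bsub>M\<^esub> (t' \<odot>\<^bsub>M\<^esub> (u \<odot>\<^bsub>M\<^esub> (s \<odot>\<^bsub>M\<^esub> m')))) \<oplus>\<^bsub>M\<^esub>
        u \<odot>\<^bsub>M\<^esub> (s \<odot>\<^bsub>M\<^esub> (s' \<odot>\<^bsub>M\<^esub> (v \<odot>\<^bsub>M\<^esub> (t \<odot>\<^bsub>M\<^esub> n'))))"
    using c assms by (simp add: smult_r_distr smult_assoc1[symmetric] R.m_ac)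
  also have "\<dots> = (u \<otimes> v) \<odot>\<^bsub>M\<^esub> ((s' \<otimes> t') \<odot>\<^bsub>M\<^esub> ((t \<odot>\<^bsub>M\<^esub> m) \<oplus>\<^bsub>M\<^esub> (s \<odot>\<^bsub>M\<^esub> n)))"
    unfolding u(2)[symmetric] v(2)[symmetric]
    using c assms by (simp add: smult_r_distr smult_assoc1[symmetric] R.m_ac)
  finally have "(u \<otimes> v) \<odot>\<^bsub>M\<^esub> ((s \<otimes> t) \<odot>\<^bsub>M\<^esub> ((t' \<odot>\<^bsub>M\<^esub> m') \<oplus>\<^bsub>M\<^esub> (s' \<odot>\<^bsub>M\<^esub> n')))
    = (u \<otimes> v) \<odot>\<^bsub>M\<^esub> ((s' \<otimes> t') \<odot>\<^bsub>M\<^esub> ((t \<odot>\<^bsub>M\<^esub> m) \<oplus>\<^bsub>M\<^esub> (s \<odot>\<^bsub>M\<^esub> n)))" .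
  moreover have "u \<otimes> v \<in> S" "s \<otimes> t \<in> S" "s' \<otimes> t' \<in> S" using mult_S u v assms by blast+
  ultimately show ?thesis
    using assms c by (subst fraction_eq_iff) blast+
qed

lemma regular_localization: "localization R (regular_module R) p"
  by (intro localization.intro regular_module primeideal)

lemma smult_cong:
  assumes "a \<in> carrier R" "s \<in> S" "a' \<in> carrier R" "s' \<in> S"
    and "fraction R p (regular_module R) a s = fraction R p (regular_module R) a' s'"
    and "n \<in> carrier M" "t \<in> S" "n' \<in> carrier M" "t' \<in> S" "frac n t = frac n' t'"
  shows "frac (a' \<odot>\<^bsub>M\<^esub> n') (s' \<otimes> t') = frac (a \<odot>\<^bsub>M\<^esub> n) (s \<otimes> t)"
proof -
  obtain u where u: "u \<in> S" "u \<otimes> (s' \<otimes> a) = u \<otimes> (s \<otimes> a')"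
    using assms localization.fraction_eq_iff[OF regular_localization, of a a' s s'] by auto
  obtain v where v: "v \<in> S" "v \<odot>\<^bsub>M\<^esub> (t' \<odot>\<^bsub>M\<^esub> n) = v \<odot>\<^bsub>M\<^esub> (t \<odot>\<^bsub>M\<^esub> n')"
    using assms by (auto simp: fraction_eq_iff)
  have c: "u \<in> carrier R" "v \<in> carrier R" "s \<in> carrier R" "t \<in> carrier R"
    "s' \<in> carrier R" "t' \<in> carrier R" using assms u v by auto
  have "(u \<otimes> v) \<odot>\<^bsub>M\<^esub> ((s \<otimes> t) \<odot>\<^bsub>M\<^esub> (a' \<odot>\<^bsub>M\<^esub> n'))
      = (u \<otimes> (s \<otimes> a')) \<odot>\<^bsub>M\<^esub> (v \<odot>\<^bsub>M\<^esub> (t \<odot>\<^bsub>M\<^esub> n'))"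
    using c assms by (simp add: smult_assoc1[symmetric] R.m_ac)
  also have "\<dots> = (u \<otimes> v) \<odot>\<^bsub>M\<^esub> ((s' \<otimes> t') \<odot>\<^bsub>M\<^esub> (a \<odot>\<^bsub>M\<^esub> n))"
    unfolding u(2)[symmetric] v(2)[symmetric]
    using c assms by (simp add: smult_assoc1[symmetric] R.m_ac)
  finally have "(u \<otimes> v) \<odot>\<^bsub>M\<^esub> ((s \<otimes> t) \<odot>\<^bsub>M\<^esub> (a' \<odot>\<^bsub>M\<^esub> n'))
    = (u \<otimes> v) \<odot>\<^bsub>M\<^esub> ((s' \<otimes> t') \<odot>\<^bsub>M\<^esub> (a \<odot>\<^bsub>M\<^esub> n))" .
  moreover have "u \<otimes> v \<in> S" "s \<otimes> t \<in> S" "s' \<otimes> t' \<in> S" using mult_S u v assms by blast+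
  ultimately show ?thesis
    using assms c by (subst fraction_eq_iff) blast+
qed

lemma localize_module_simps:
  "\<zero>\<^bsub>localize_module R p M\<^esub> = frac \<zero>\<^bsub>M\<^esub> \<one>"
  "\<lbrakk>m \<in> carrier M; s \<in> S; n \<in> carrier M; t \<in> S\<rbrakk> \<Longrightarrow>
     frac m s \<oplus>\<^bsub>localize_module R p M\<^esub> frac n t =
     frac ((t \<odot>\<^bsub>M\<^esub> m) \<oplus>\<^bsub>M\<^esub> (s \<odot>\<^bsub>M\<^esub> n)) (s \<otimes> t)"
  "\<lbrakk>a \<in> carrier R; s \<in> S; n \<in> carrier M; t \<in> S\<rbrakk> \<Longrightarrow>
     fraction R p (regular_module R) a s \<odot>\<^bsub>localize_module R p M\<^esub> frac n t =
     frac (a \<odot>\<^bsub>M\<^esub> n) (s \<otimes> t)"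
proof -
  show "\<zero>\<^bsub>localize_module R p M\<^esub> = frac \<zero>\<^bsub>M\<^esub> \<one>"
    by (simp add: localize_module_def Let_def)
next
  assume *: "m \<in> carrier M" "s \<in> S" "n \<in> carrier M" "t \<in> S"
  have inner: "(\<Union>(n', t')\<in>frac n t. frac ((t' \<odot>\<^bsub>M\<^esub> m') \<oplus>\<^bsub>M\<^esub> (s' \<odot>\<^bsub>M\<^esub> n')) (s' \<otimes> t')) =
     frac ((t \<odot>\<^bsub>M\<^esub> m') \<oplus>\<^bsub>M\<^esub> (s' \<odot>\<^bsub>M\<^esub> n)) (s' \<otimes> t)"
    if "m' \<in> carrier M" "s' \<in> S" for m' s'
    using * that by (intro UN_fraction add_cong) auto
  have "(\<Union>(m', s')\<in>frac m s. \<Union>(n', t')\<in>frac n t.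
          frac ((t' \<odot>\<^bsub>M\<^esub> m') \<oplus>\<^bsub>M\<^esub> (s' \<odot>\<^bsub>M\<^esub> n')) (s' \<otimes> t')) =
     (\<Union>(n', t')\<in>frac n t. frac ((t' \<odot>\<^bsub>M\<^esub> m) \<oplus>\<^bsub>M\<^esub> (s \<odot>\<^bsub>M\<^esub> n')) (s \<otimes> t'))"
  proof (intro UN_fraction)
    fix m' s' assume m': "m' \<in> carrier M" "s' \<in> S" "frac m s = frac m' s'"
    have "frac ((t \<odot>\<^bsub>M\<^esub> m') \<oplus>\<^bsub>M\<^esub> (s' \<odot>\<^bsub>M\<^esub> n)) (s' \<otimes> t) =
          frac ((t \<odot>\<^bsub>M\<^esub> m) \<oplus>\<^bsub>M\<^esub> (s \<odot>\<^bsub>M\<^esub> n)) (s \<otimes> t)"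
      using * m' by (intro add_cong) auto
    thus "(\<Union>(n', t')\<in>frac n t. frac ((t' \<odot>\<^bsub>M\<^esub> m') \<oplus>\<^bsub>M\<^esub> (s' \<odot>\<^bsub>M\<^esub> n')) (s' \<otimes> t')) =
      (\<Union>(n', t')\<in>frac n t. frac ((t' \<odot>\<^bsub>M\<^esub> m) \<oplus>\<^bsub>M\<^esub> (s \<odot>\<^bsub>M\<^esub> n')) (s \<otimes> t'))"
      using * m' by (simp add: inner)
  qed (use * in auto)
  thus "frac m s \<oplus>\<^bsub>localize_module R p M\<^esub> frac n t =
     frac ((t \<odot>\<^bsub>M\<^esub> m) \<oplus>\<^bsub>M\<^esub> (s \<odot>\<^bsub>M\<^esub> n)) (s \<otimes> t)"
    using * by (simp add: localize_module_def Let_def inner)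
next
  assume *: "a \<in> carrier R" "s \<in> S" "n \<in> carrier M" "t \<in> S"
  have inner: "(\<Union>(n', t')\<in>frac n t. frac (a' \<odot>\<^bsub>M\<^esub> n') (s' \<otimes> t')) =
     frac (a' \<odot>\<^bsub>M\<^esub> n) (s' \<otimes> t)"
    if "a' \<in> carrier R" "s' \<in> S" for a' s'
    using * that by (intro UN_fraction smult_cong) auto
  have "(\<Union>(a', s')\<in>fraction R p (regular_module R) a s. \<Union>(n', t')\<in>frac n t.
          frac (a' \<odot>\<^bsub>M\<^esub> n') (s' \<otimes> t')) =
     (\<Union>(n', t')\<in>frac n t. frac (a \<odot>\<^bsub>M\<^esub> n') (s \<otimes> t'))"
  proof (intro localization.UN_fraction[OF regular_localization])
    fix a' s' assume a': "a' \<in> carrier (regular_module R)" "s' \<in> S"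
      "fraction R p (regular_module R) a s = fraction R p (regular_module R) a' s'"
    have "frac (a' \<odot>\<^bsub>M\<^esub> n) (s' \<otimes> t) = frac (a \<odot>\<^bsub>M\<^esub> n) (s \<otimes> t)"
      using * a' by (intro smult_cong) auto
    thus "(\<Union>(n', t')\<in>frac n t. frac (a' \<odot>\<^bsub>M\<^esub> n') (s' \<otimes> t')) =
      (\<Union>(n', t')\<in>frac n t. frac (a \<odot>\<^bsub>M\<^esub> n') (s \<otimes> t'))"
      using * a' by (simp add: inner)
  qed (use * in auto)
  thus "fraction R p (regular_module R) a s \<odot>\<^bsub>localize_module R p M\<^esub> frac n t =
     frac (a \<odot>\<^bsub>M\<^esub> n) (s \<otimes> t)"
    using * by (simp add: localize_module_def Let_def inner)
qed

lemma localize_ring_eq: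
  "localize_ring R p =
    \<lparr>carrier = carrier (localize_module R p (regular_module R)),
     mult = smult (localize_module R p (regular_module R)),
     one = fraction R p (regular_module R) \<one> \<one>,
     zero = \<zero>\<^bsub>localize_module R p (regular_module R)\<^esub>,
     add = add (localize_module R p (regular_module R))\<rparr>"
  by (simp add: localize_ring_def localize_module_def Let_def)

lemma carrier_localize_ring:
  "carrier (localize_ring R p) =
     {fraction R p (regular_module R) a s | a s. a \<in> carrier R \<and> s \<in> S}"
  by (simp add: localize_ring_eq localization.carrier_localize_module[OF regular_localization])

lemma localize_ring_simps:
  "\<zero>\<^bsub>localize_ring R p\<^esub> = fraction R p (regular_module R) \<zero> \<one>"
  "\<one>\<^bsub>localize_ring R p\<^esub> = fraction R p (regular_module R) \<one> \<one>"
  "\<lbrakk>a \<in> carrier R; s \<in> S; b \<in> carrier R; t \<in> S\<rbrakk> \<Longrightarrow>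
     fraction R p (regular_module R) a s \<oplus>\<^bsub>localize_ring R p\<^esub> fraction R p (regular_module R) b t =
     fraction R p (regular_module R) ((t \<otimes> a) \<oplus> (s \<otimes> b)) (s \<otimes> t)"
  "\<lbrakk>a \<in> carrier R; s \<in> S; b \<in> carrier R; t \<in> S\<rbrakk> \<Longrightarrow>
     fraction R p (regular_module R) a s \<otimes>\<^bsub>localize_ring R p\<^esub> fraction R p (regular_module R) b t =
     fraction R p (regular_module R) (a \<otimes> b) (s \<otimes> t)"
  by (simp_all add: localize_ring_eq localization.localize_module_simps[OF regular_localization])

lemma abelian_group_localize_module: "abelian_group (localize_module R p M)"
proof -
  show ?thesis
  proof (rule abelian_groupI)
    fix x y assume "x \<in> carrier (localize_module R p M)" "y \<in> carrier (localize_module R p M)"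
    then obtain m s n t where x: "x = frac m s" "m \<in> carrier M" "s \<in> S"
      and y: "y = frac n t" "n \<in> carrier M" "t \<in> S"
      by (auto simp: carrier_localize_module)
    have st: "s \<otimes> t \<in> S" "t \<otimes> s \<in> S" using x y mult_S by blast+
    show "x \<oplus>\<^bsub>localize_module R p M\<^esub> y \<in> carrier (localize_module R p M)"
      using x y st unfolding carrier_localize_module
      by (auto simp: localize_module_simps)
    show "x \<oplus>\<^bsub>localize_module R p M\<^esub> y = y \<oplus>\<^bsub>localize_module R p M\<^esub> x"
      using x y st by (auto simp: localize_module_simps M.a_comm R.m_comm)
    fix z assume "z \<in> carrier (localize_module R p M)"
    then obtain k w where z: "z = frac k w" "k \<in> carrier M" "w \<in> S"
      by (auto simp: carrier_localize_module)
    have S3: "(s \<otimes> t) \<otimes> w \<in> S" "s \<otimes> (t \<otimes> w) \<in> S" "t \<otimes> w \<in> S" using x y z mult_S by blast+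
    show "x \<oplus>\<^bsub>localize_module R p M\<^esub> y \<oplus>\<^bsub>localize_module R p M\<^esub> z =
          x \<oplus>\<^bsub>localize_module R p M\<^esub> (y \<oplus>\<^bsub>localize_module R p M\<^esub> z)"
      using x y z st S3
      by (auto simp: localize_module_simps smult_r_distr smult_assoc1[symmetric] R.m_ac M.a_ac)
  next
    show "\<zero>\<^bsub>localize_module R p M\<^esub> \<in> carrier (localize_module R p M)"
      using one_S by (auto simp: carrier_localize_module localize_module_simps)
  next
    fix x assume "x \<in> carrier (localize_module R p M)"
    then obtain m s where x: "x = frac m s" "m \<in> carrier M" "s \<in> S"
      by (auto simp: carrier_localize_module)
    show "\<zero>\<^bsub>localize_module R p M\<^esub> \<oplus>\<^bsub>localize_module R p M\<^esub> x = x"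
      using x one_S by (auto simp: localize_module_simps)
    have ss: "s \<otimes> s \<in> S" using x mult_S by blast
    have "frac \<zero>\<^bsub>M\<^esub> (s \<otimes> s) = frac \<zero>\<^bsub>M\<^esub> \<one>"
      using x ss one_S by (intro fraction_eqI) auto
    hence "frac (\<ominus>\<^bsub>M\<^esub> m) s \<oplus>\<^bsub>localize_module R p M\<^esub> x = \<zero>\<^bsub>localize_module R p M\<^esub>"
      using x by (simp add: localize_module_simps smult_r_minus M.l_neg)
    moreover have "frac (\<ominus>\<^bsub>M\<^esub> m) s \<in> carrier (localize_module R p M)"
      using x M.a_inv_closed unfolding carrier_localize_module by blast
    ultimately show "\<exists>y\<in>carrier (localize_module R p M).
        y \<oplus>\<^bsub>localize_module R p M\<^esub> x = \<zero>\<^bsub>localize_module R p M\<^esub>"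
      by blast
  qed
qed

lemma fraction_cancel:
  assumes "m \<in> carrier M" "s \<in> S" "t \<in> S"
  shows "frac (t \<odot>\<^bsub>M\<^esub> m) (t \<otimes> s) = frac m s"
  using assms mult_S[of t s] by (intro fraction_eqI) (auto simp: smult_assoc1[symmetric] R.m_ac)

theorem cring_localize_ring: "cring (localize_ring R p)"
proof -
  interpret L: localization R "regular_module R" p by (rule regular_localization)
  let ?f = "fraction R p (regular_module R)"
  have ag: "abelian_group (localize_ring R p)"
  proof -
    interpret G: abelian_group "localize_module R p (regular_module R)"
      by (rule L.abelian_group_localize_module)
    show ?thesis
      by (rule abelian_groupI)
        (auto simp: localize_ring_eq G.a_ac intro: G.l_neg G.a_inv_closed)
  qed
  show ?thesis
  proof (rule cringI[OF ag])
    show "Group.comm_monoid (localize_ring R p)"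
    proof (rule comm_monoidI)
      fix x y assume "x \<in> carrier (localize_ring R p)" "y \<in> carrier (localize_ring R p)"
      then obtain a s b t where x: "x = ?f a s" "a \<in> carrier R" "s \<in> S"
        and y: "y = ?f b t" "b \<in> carrier R" "t \<in> S"
        by (auto simp: carrier_localize_ring)
      have st: "s \<otimes> t \<in> S" using x y mult_S by blast
      show "x \<otimes>\<^bsub>localize_ring R p\<^esub> y \<in> carrier (localize_ring R p)"
        using x y st unfolding carrier_localize_ring by (auto simp: localize_ring_simps)
      show "x \<otimes>\<^bsub>localize_ring R p\<^esub> y = y \<otimes>\<^bsub>localize_ring R p\<^esub> x"
        using x y by (auto simp: localize_ring_simps R.m_comm)
      fix z assume "z \<in> carrier (localize_ring R p)"
      then obtain c w where z: "z = ?f c w" "c \<in> carrier R" "w \<in> S"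
        by (auto simp: carrier_localize_ring)
      have "t \<otimes> w \<in> S" using y z mult_S by blast
      thus "x \<otimes>\<^bsub>localize_ring R p\<^esub> y \<otimes>\<^bsub>localize_ring R p\<^esub> z =
            x \<otimes>\<^bsub>localize_ring R p\<^esub> (y \<otimes>\<^bsub>localize_ring R p\<^esub> z)"
        using x y z st by (auto simp: localize_ring_simps R.m_assoc)
    next
      show "\<one>\<^bsub>localize_ring R p\<^esub> \<in> carrier (localize_ring R p)"
        using one_S by (auto simp: localize_ring_simps carrier_localize_ring)
    next
      fix x assume "x \<in> carrier (localize_ring R p)"
      then obtain a s where x: "x = ?f a s" "a \<in> carrier R" "s \<in> S"
        by (auto simp: carrier_localize_ring)
      thus "\<one>\<^bsub>localize_ring R p\<^esub> \<otimes>\<^bsub>localize_ring R p\<^esub> x = x"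
        using one_S by (auto simp: localize_ring_simps)
    qed
  next
    fix x y z assume "x \<in> carrier (localize_ring R p)" "y \<in> carrier (localize_ring R p)"
      "z \<in> carrier (localize_ring R p)"
    then obtain a s b t c w where x: "x = ?f a s" "a \<in> carrier R" "s \<in> S"
      and y: "y = ?f b t" "b \<in> carrier R" "t \<in> S"
      and z: "z = ?f c w" "c \<in> carrier R" "w \<in> S"
      by (auto simp: carrier_localize_ring)
    have st: "s \<otimes> t \<in> S" "s \<otimes> w \<in> S" "t \<otimes> w \<in> S" "(s \<otimes> t) \<otimes> w \<in> S"
      using x y z mult_S by blast+
    have "?f (w \<otimes> ((t \<otimes> a \<oplus> s \<otimes> b) \<otimes> c)) (w \<otimes> ((s \<otimes> t) \<otimes> w)) =
          ?f ((t \<otimes> a \<oplus> s \<otimes> b) \<otimes> c) ((s \<otimes> t) \<otimes> w)"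
      using x y z st L.fraction_cancel[of "(t \<otimes> a \<oplus> s \<otimes> b) \<otimes> c" "(s \<otimes> t) \<otimes> w" w]
      by auto
    moreover have "w \<otimes> ((t \<otimes> a \<oplus> s \<otimes> b) \<otimes> c) = (t \<otimes> w) \<otimes> (a \<otimes> c) \<oplus> (s \<otimes> w) \<otimes> (b \<otimes> c)"
      using x y z by (simp add: R.l_distr R.r_distr R.m_ac)
    moreover have "w \<otimes> ((s \<otimes> t) \<otimes> w) = (s \<otimes> w) \<otimes> (t \<otimes> w)"
      using x y z by (simp add: R.m_ac)
    ultimately show "(x \<oplus>\<^bsub>localize_ring R p\<^esub> y) \<otimes>\<^bsub>localize_ring R p\<^esub> z =
        x \<otimes>\<^bsub>localize_ring R p\<^esub> z \<oplus>\<^bsub>localize_ring R p\<^esub> y \<otimes>\<^bsub>localize_ring R p\<^esub> z"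
      using x y z st by (auto simp: localize_ring_simps)
  qed
qed

theorem module_localize_module: "module (localize_ring R p) (localize_module R p M)"
proof (rule moduleI[OF cring_localize_ring abelian_group_localize_module])
  let ?f = "fraction R p (regular_module R)"
  fix x z assume "x \<in> carrier (localize_ring R p)" "z \<in> carrier (localize_module R p M)"
  then obtain a s m w where x: "x = ?f a s" "a \<in> carrier R" "s \<in> S"
    and z: "z = frac m w" "m \<in> carrier M" "w \<in> S"
    by (auto simp: carrier_localize_ring carrier_localize_module)
  have sw: "s \<otimes> w \<in> S" using x z mult_S by blast
  show "x \<odot>\<^bsub>localize_module R p M\<^esub> z \<in> carrier (localize_module R p M)"
    using x z sw unfolding carrier_localize_module by (auto simp: localize_module_simps)
  {
    fix y assume "y \<in> carrier (localize_ring R p)"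
    then obtain b t where y: "y = ?f b t" "b \<in> carrier R" "t \<in> S"
      by (auto simp: carrier_localize_ring)
    have st: "s \<otimes> t \<in> S" "t \<otimes> w \<in> S" "(s \<otimes> t) \<otimes> w \<in> S" using x y z mult_S by blast+
    show "x \<otimes>\<^bsub>localize_ring R p\<^esub> y \<odot>\<^bsub>localize_module R p M\<^esub> z =
          x \<odot>\<^bsub>localize_module R p M\<^esub> (y \<odot>\<^bsub>localize_module R p M\<^esub> z)"
      using x y z st by (auto simp: localize_module_simps localize_ring_simps smult_assoc1 R.m_assoc)
    have "frac (w \<odot>\<^bsub>M\<^esub> ((t \<otimes> a \<oplus> s \<otimes> b) \<odot>\<^bsub>M\<^esub> m)) (w \<otimes> ((s \<otimes> t) \<otimes> w)) =
          frac ((t \<otimes> a \<oplus> s \<otimes> b) \<odot>\<^bsub>M\<^esub> m) ((s \<otimes> t) \<otimes> w)"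
      using x y z st by (intro fraction_cancel) auto
    moreover have "w \<odot>\<^bsub>M\<^esub> ((t \<otimes> a \<oplus> s \<otimes> b) \<odot>\<^bsub>M\<^esub> m) =
        (t \<otimes> w) \<odot>\<^bsub>M\<^esub> (a \<odot>\<^bsub>M\<^esub> m) \<oplus>\<^bsub>M\<^esub> (s \<otimes> w) \<odot>\<^bsub>M\<^esub> (b \<odot>\<^bsub>M\<^esub> m)"
      using x y z by (simp add: smult_l_distr smult_r_distr smult_assoc1[symmetric] R.m_ac)
    moreover have "w \<otimes> ((s \<otimes> t) \<otimes> w) = (s \<otimes> w) \<otimes> (t \<otimes> w)"
      using x y z by (simp add: R.m_ac)
    ultimately show "(x \<oplus>\<^bsub>localize_ring R p\<^esub> y) \<odot>\<^bsub>localize_module R p M\<^esub> z =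
        x \<odot>\<^bsub>localize_module R p M\<^esub> z \<oplus>\<^bsub>localize_module R p M\<^esub> y \<odot>\<^bsub>localize_module R p M\<^esub> z"
      using x y z st sw by (auto simp: localize_module_simps localize_ring_simps)
  }
  {
    fix y assume "y \<in> carrier (localize_module R p M)"
    then obtain n t where y: "y = frac n t" "n \<in> carrier M" "t \<in> S"
      by (auto simp: carrier_localize_module)
    have st: "w \<otimes> t \<in> S" "s \<otimes> t \<in> S" "s \<otimes> (w \<otimes> t) \<in> S" using x y z mult_S by blast+
    have "frac (s \<odot>\<^bsub>M\<^esub> (a \<odot>\<^bsub>M\<^esub> (t \<odot>\<^bsub>M\<^esub> m \<oplus>\<^bsub>M\<^esub> w \<odot>\<^bsub>M\<^esub> n))) (s \<otimes> (s \<otimes> (w \<otimes> t))) =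
          frac (a \<odot>\<^bsub>M\<^esub> (t \<odot>\<^bsub>M\<^esub> m \<oplus>\<^bsub>M\<^esub> w \<odot>\<^bsub>M\<^esub> n)) (s \<otimes> (w \<otimes> t))"
      using x y z st by (intro fraction_cancel) auto
    moreover have "s \<odot>\<^bsub>M\<^esub> (a \<odot>\<^bsub>M\<^esub> (t \<odot>\<^bsub>M\<^esub> m \<oplus>\<^bsub>M\<^esub> w \<odot>\<^bsub>M\<^esub> n)) =
        (s \<otimes> t) \<odot>\<^bsub>M\<^esub> (a \<odot>\<^bsub>M\<^esub> m) \<oplus>\<^bsub>M\<^esub> (s \<otimes> w) \<odot>\<^bsub>M\<^esub> (a \<odot>\<^bsub>M\<^esub> n)"
      using x y z by (simp add: smult_r_distr smult_assoc1[symmetric] R.m_ac)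
    moreover have "s \<otimes> (s \<otimes> (w \<otimes> t)) = (s \<otimes> w) \<otimes> (s \<otimes> t)"
      using x y z by (simp add: R.m_ac)
    ultimately show "x \<odot>\<^bsub>localize_module R p M\<^esub> (z \<oplus>\<^bsub>localize_module R p M\<^esub> y) =
        x \<odot>\<^bsub>localize_module R p M\<^esub> z \<oplus>\<^bsub>localize_module R p M\<^esub> x \<odot>\<^bsub>localize_module R p M\<^esub> y"
      using x y z st sw by (auto simp: localize_module_simps)
  }
next
  fix x assume "x \<in> carrier (localize_module R p M)"
  thus "\<one>\<^bsub>localize_ring R p\<^esub> \<odot>\<^bsub>localize_module R p M\<^esub> x = x"
    using one_S by (auto simp: carrier_localize_module localize_module_simps localize_ring_simps)
qed

lemma localize_hom_fraction:
  assumes A: "submodule A R M" and B: "submodule B R M"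
    and f: "f \<in> module_hom R (restrict_module M A) (restrict_module M B)"
    and a: "a \<in> A" and s: "s \<in> S"
  shows "localize_hom R p M A f (frac a s) = frac (f a) s"
proof -
  have AM: "A \<subseteq> carrier M" and BM: "B \<subseteq> carrier M"
    using submoduleE(1) A B by auto
  have sA: "r \<odot>\<^bsub>M\<^esub> x \<in> A" if "r \<in> carrier R" "x \<in> A" for r x
    using submoduleE(4)[OF A] that by blast
  have fB: "f x \<in> B" if "x \<in> A" for x using f that by (auto simp: module_hom_def)
  have fs: "f (r \<odot>\<^bsub>M\<^esub> x) = r \<odot>\<^bsub>M\<^esub> f x" if "r \<in> carrier R" "x \<in> A" for r x
    using f that by (auto simp: module_hom_def)
  have eq: "frac (f b) t = frac (f a) s" if bt: "(b, t) \<in> frac a s" "b \<in> A" for b t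
  proof -
    obtain u where u: "u \<in> S" "t \<in> S" "u \<odot>\<^bsub>M\<^esub> (t \<odot>\<^bsub>M\<^esub> a) = u \<odot>\<^bsub>M\<^esub> (s \<odot>\<^bsub>M\<^esub> b)"
      using bt by (auto simp: fraction_def localization_rel_def)
    have "u \<odot>\<^bsub>M\<^esub> (t \<odot>\<^bsub>M\<^esub> f a) = f (u \<odot>\<^bsub>M\<^esub> (t \<odot>\<^bsub>M\<^esub> a))"
      using u a sA[of t a] fs[of t a] fs[of u "t \<odot>\<^bsub>M\<^esub> a"] by auto
    also have "\<dots> = u \<odot>\<^bsub>M\<^esub> (s \<odot>\<^bsub>M\<^esub> f b)"
      unfolding u(3) using u bt s sA[of s b] fs[of s b] fs[of u "s \<odot>\<^bsub>M\<^esub> b"] by auto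
    finally have "u \<odot>\<^bsub>M\<^esub> (s \<odot>\<^bsub>M\<^esub> f b) = u \<odot>\<^bsub>M\<^esub> (t \<odot>\<^bsub>M\<^esub> f a)" by simp
    thus ?thesis using u s a bt fB BM by (subst fraction_eq_iff) blast+
  qed
  have "(a, s) \<in> frac a s"
    using equiv_class_self[OF equiv_localization, of "(a, s)"] a s AM by (auto simp: fraction_def)
  thus ?thesis using eq a unfolding localize_hom_def by fast
qed

end

end

theory Submission
  imports Defs
begin

text \<open>
  The C4 property only involves decompositions, homomorphisms, images and isomorphisms, and
  localization preserves all of these.  A decomposition \<open>M\<^sub>p = U \<oplus> V\<close> and a homomorphism \<open>g\<close> from
  \<open>U\<close> to \<open>V\<close> come from a decomposition \<open>M = A \<oplus> B\<close> and a homomorphism \<open>f\<close> from \<open>A\<close> to \<open>B\<close>, by the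
  two lifting hypotheses.  The C4 property of \<open>M\<close> gives \<open>B = D \<oplus> E\<close> and an isomorphism from \<open>f ` A\<close>
  onto \<open>D\<close>.  Localizing, \<open>g ` U = (f ` A)\<^sub>p\<close> (\<open>localize_hom_image\<close>) is isomorphic to \<open>D\<^sub>p\<close>
  (\<open>module_isomorphic_localize\<close>), and \<open>V = B\<^sub>p = D\<^sub>p \<oplus> E\<^sub>p\<close> (\<open>direct_decomposition_localize\<close>).

  Sums and images are localized by computing with representatives.  Intersections and injectivity
  need the exactness of localization: an equality of fractions becomes an equality of elements
  of \<open>M\<close> after clearing denominators and multiplying by some \<open>u\<close> outside \<open>p\<close>.  This gives
  \<open>D\<^sub>p \<inter> E\<^sub>p = 0\<close> from \<open>D \<inter> E = 0\<close> (\<open>localize_submodule_Int\<close>) and the injectivity of a localized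
  map from that of the map (\<open>inj_on_localize_hom\<close>).
\<close>

section \<open>Submodules of submodules and images of homomorphisms\<close>

lemma (in module) submodule_restrict_iff:
  assumes "submodule B R M"
  shows "submodule D R (restrict_module M B) \<longleftrightarrow> submodule D R M \<and> D \<subseteq> B"
proof -
  have B: "module R (restrict_module M B)"
    using submodule.submodule_is_module[OF assms] module_axioms .
  have BM: "B \<subseteq> carrier M" by (rule submoduleE(1)[OF assms])
  show ?thesis
  proof (intro iffI conjI)
    assume D: "submodule D R (restrict_module M B)"
    show DB: "D \<subseteq> B" using module.submoduleE(1)[OF B D] by simp
    show "submodule D R M"
      using submodule.submodule_is_module[OF D B] DB BM
      by (intro module_incl_imp_submodule) auto
  next
    assume D: "submodule D R M \<and> D \<subseteq> B"
    then show "submodule D R (restrict_module M B)"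
      using submodule.submodule_is_module[of D R M] module_axioms
      by (intro module.module_incl_imp_submodule[OF B]) auto
  qed
qed

lemma (in module) image_submodule:
  assumes A: "submodule A R M" and B: "submodule B R M"
    and f: "f \<in> module_hom R (restrict_module M A) (restrict_module M B)"
  shows "submodule (f ` A) R M"
proof -
  have fB: "f x \<in> carrier M" if "x \<in> A" for x
    using f that submoduleE(1)[OF B] by (auto simp: module_hom_def)
  have fa: "f (x \<oplus>\<^bsub>M\<^esub> y) = f x \<oplus>\<^bsub>M\<^esub> f y" if "x \<in> A" "y \<in> A" for x y
    using f that by (auto simp: module_hom_def)
  have fs: "f (r \<odot>\<^bsub>M\<^esub> x) = r \<odot>\<^bsub>M\<^esub> f x" if "r \<in> carrier R" "x \<in> A" for r x
    using f that by (auto simp: module_hom_def)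
  \<comment> \<open>Zero and negatives are the multiples by \<open>0\<close> and \<open>-1\<close>, so compatibility with scalars covers them.\<close>
  obtain a where a: "a \<in> A" using submoduleE(2)[OF A] by blast
  have "\<zero>\<^bsub>M\<^esub> = f (\<zero> \<odot>\<^bsub>M\<^esub> a)" using a fs fB by simp
  then have zero: "\<zero>\<^bsub>M\<^esub> \<in> f ` A" using submoduleE(4)[OF A _ a] by blast
  have neg: "\<ominus>\<^bsub>M\<^esub> f x \<in> f ` A" if x: "x \<in> A" for x
  proof -
    have "\<ominus>\<^bsub>M\<^esub> f x = f ((\<ominus> \<one>) \<odot>\<^bsub>M\<^esub> x)" using x fs fB by (simp add: smult_l_minus)
    then show ?thesis using submoduleE(4)[OF A _ x] by blast
  qed
  show ?thesis
  proof (rule submoduleI)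
    show "f ` A \<subseteq> carrier M" using fB by blast
    show "\<zero>\<^bsub>M\<^esub> \<in> f ` A" by (rule zero)
    show "\<ominus>\<^bsub>M\<^esub> y \<in> f ` A" if "y \<in> f ` A" for y using that neg by blast
    show "y \<oplus>\<^bsub>M\<^esub> z \<in> f ` A" if "y \<in> f ` A" "z \<in> f ` A" for y z
      using that fa submoduleE(5)[OF A] by (metis (no_types, lifting) image_iff)
    show "r \<odot>\<^bsub>M\<^esub> y \<in> f ` A" if "r \<in> carrier R" "y \<in> f ` A" for r y
      using that fs submoduleE(4)[OF A] by (metis (no_types, lifting) image_iff)
  qed
qed

section \<open>Localized submodules and decompositions\<close>

context localization
begin

lemma localize_submoduleI: "n \<in> N \<Longrightarrow> s \<in> S \<Longrightarrow> frac n s \<in> localize_submodule R p M N"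
  by (auto simp: localize_submodule_def)

lemma submodule_localize:
  assumes N: "submodule N R M"
  shows "submodule (localize_submodule R p M N) (localize_ring R p) (localize_module R p M)"
proof -
  let ?Mp = "localize_module R p M"
  interpret L: module "localize_ring R p" ?Mp by (rule module_localize_module)
  have NM: "N \<subseteq> carrier M" by (rule submoduleE(1)[OF N])
  have scal: "r \<odot>\<^bsub>?Mp\<^esub> x \<in> localize_submodule R p M N"
    if r: "r \<in> carrier (localize_ring R p)" and x: "x \<in> localize_submodule R p M N" for r x
  proof -
    obtain a s n t where "r = fraction R p (regular_module R) a s" "a \<in> carrier R" "s \<in> S"
      and "x = frac n t" "n \<in> N" "t \<in> S"
      using r x by (auto simp: carrier_localize_ring localize_submodule_def)
    then show ?thesis
      using NM submoduleE(4)[OF N] mult_S localize_submoduleI by (auto simp: localize_module_simps)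
  qed
  have sub: "localize_submodule R p M N \<subseteq> carrier ?Mp"
    using NM by (auto simp: localize_submodule_def carrier_localize_module)
  obtain n where n: "n \<in> N" using submoduleE(2)[OF N] by blast
  show ?thesis
  proof (rule L.submoduleI[OF sub])
    show "\<zero>\<^bsub>?Mp\<^esub> \<in> localize_submodule R p M N"
      using scal[OF L.R.zero_closed localize_submoduleI[OF n one_S]] sub localize_submoduleI[OF n one_S] by auto
    show "\<ominus>\<^bsub>?Mp\<^esub> x \<in> localize_submodule R p M N" if x: "x \<in> localize_submodule R p M N" for x
      using scal[OF L.R.a_inv_closed[OF L.R.one_closed] x] sub x
      by (simp add: L.smult_l_minus subset_iff)
    show "x \<oplus>\<^bsub>?Mp\<^esub> y \<in> localize_submodule R p M N"
      if xy: "x \<in> localize_submodule R p M N" "y \<in> localize_submodule R p M N" for x y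
    proof -
      obtain m s n t where x: "x = frac m s" "m \<in> N" "s \<in> S" and y: "y = frac n t" "n \<in> N" "t \<in> S"
        using xy by (auto simp: localize_submodule_def)
      have "t \<odot>\<^bsub>M\<^esub> m \<oplus>\<^bsub>M\<^esub> s \<odot>\<^bsub>M\<^esub> n \<in> N"
        using x y submoduleE(4,5)[OF N] by simp
      then have "frac (t \<odot>\<^bsub>M\<^esub> m \<oplus>\<^bsub>M\<^esub> s \<odot>\<^bsub>M\<^esub> n) (s \<otimes> t) \<in> localize_submodule R p M N"
        using localize_submoduleI mult_S x y by blast
      moreover have "m \<in> carrier M" "n \<in> carrier M" using x y NM by auto
      ultimately show ?thesis using x y by (simp add: localize_module_simps)
    qed
  qed (rule scal)
qed

text \<open>If \<open>a/s = b/t\<close>, then \<open>uta = usb\<close> for some \<open>u\<close> outside \<open>p\<close>; this element lies in both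
  submodules and is the numerator of the same fraction over the denominator \<open>uts\<close>.\<close>

lemma localize_submodule_Int:
  assumes A: "submodule A R M" and B: "submodule B R M"
  shows "localize_submodule R p M A \<inter> localize_submodule R p M B = localize_submodule R p M (A \<inter> B)"
proof (intro equalityI subsetI)
  fix x assume "x \<in> localize_submodule R p M A \<inter> localize_submodule R p M B"
  then obtain a s b t where x: "x = frac a s" "frac a s = frac b t"
    and ab: "a \<in> A" "s \<in> S" "b \<in> B" "t \<in> S"
    by (auto simp: localize_submodule_def)
  have c: "a \<in> carrier M" "b \<in> carrier M"
    using ab submoduleE(1)[OF A] submoduleE(1)[OF B] by auto
  obtain u where u: "u \<in> S" "u \<odot>\<^bsub>M\<^esub> (t \<odot>\<^bsub>M\<^esub> a) = u \<odot>\<^bsub>M\<^esub> (s \<odot>\<^bsub>M\<^esub> b)"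
    using x(2) fraction_eq_iff[OF c ab(2,4)] by blast
  have "u \<odot>\<^bsub>M\<^esub> (t \<odot>\<^bsub>M\<^esub> a) \<in> A" "u \<odot>\<^bsub>M\<^esub> (s \<odot>\<^bsub>M\<^esub> b) \<in> B"
    using u(1) ab submoduleE(4)[OF A] submoduleE(4)[OF B] by auto
  then have mem: "u \<odot>\<^bsub>M\<^esub> (t \<odot>\<^bsub>M\<^esub> a) \<in> A \<inter> B" using u(2) by simp
  have "frac (u \<odot>\<^bsub>M\<^esub> (t \<odot>\<^bsub>M\<^esub> a)) (u \<otimes> (t \<otimes> s)) = x"
    using fraction_cancel[of "t \<odot>\<^bsub>M\<^esub> a" "t \<otimes> s" u] fraction_cancel[of a s t] ab c u(1) mult_S x(1)
    by auto
  then show "x \<in> localize_submodule R p M (A \<inter> B)"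
    using mem ab u(1) mult_S unfolding localize_submodule_def by blast
qed (auto simp: localize_submodule_def)

lemma fraction_zero:
  assumes "s \<in> S" shows "frac \<zero>\<^bsub>M\<^esub> s = \<zero>\<^bsub>localize_module R p M\<^esub>"
  unfolding localize_module_simps using assms one_S by (intro fraction_eqI) auto

lemma localize_submodule_add:
  assumes A: "submodule A R M" and B: "submodule B R M"
  shows "localize_submodule R p M A <+>\<^bsub>localize_module R p M\<^esub> localize_submodule R p M B
    = localize_submodule R p M (A <+>\<^bsub>M\<^esub> B)" (is "?L = ?R")
proof (intro equalityI subsetI)
  have AM: "A \<subseteq> carrier M" and BM: "B \<subseteq> carrier M"
    using submoduleE(1)[OF A] submoduleE(1)[OF B] by auto
  {
    fix x assume "x \<in> ?L"
    then obtain a s b t where x: "x = frac a s \<oplus>\<^bsub>localize_module R p M\<^esub> frac b t"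
      and ab: "a \<in> A" "s \<in> S" "b \<in> B" "t \<in> S"
      by (auto simp: set_add_def' localize_submodule_def)
    have "a \<in> carrier M" "b \<in> carrier M" using ab AM BM by auto
    then have "x = frac (t \<odot>\<^bsub>M\<^esub> a \<oplus>\<^bsub>M\<^esub> s \<odot>\<^bsub>M\<^esub> b) (s \<otimes> t)"
      using x ab by (simp add: localize_module_simps)
    moreover have "t \<odot>\<^bsub>M\<^esub> a \<oplus>\<^bsub>M\<^esub> s \<odot>\<^bsub>M\<^esub> b \<in> A <+>\<^bsub>M\<^esub> B"
      using ab submoduleE(4)[OF A, of t a] submoduleE(4)[OF B, of s b]
      unfolding set_add_def' by blast
    ultimately show "x \<in> ?R"
      using mult_S ab unfolding localize_submodule_def by blast
  next
    fix x assume "x \<in> ?R"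
    then obtain a b s where x: "x = frac (a \<oplus>\<^bsub>M\<^esub> b) s" and ab: "a \<in> A" "b \<in> B" "s \<in> S"
      by (auto simp: set_add_def' localize_submodule_def)
    have c: "a \<in> carrier M" "b \<in> carrier M" "s \<in> carrier R" using ab AM BM by auto
    have "frac a s \<oplus>\<^bsub>localize_module R p M\<^esub> frac b s
        = frac (s \<odot>\<^bsub>M\<^esub> (a \<oplus>\<^bsub>M\<^esub> b)) (s \<otimes> s)"
      using c ab by (simp add: localize_module_simps smult_r_distr)
    also have "\<dots> = x"
      using c ab x by (simp add: fraction_cancel)
    finally have "x = frac a s \<oplus>\<^bsub>localize_module R p M\<^esub> frac b s" ..
    then show "x \<in> ?L"
      using ab unfolding set_add_def' localize_submodule_def by blast
  }
qed

text \<open>The decomposed module is an arbitrary submodule \<open>N\<close>, because the C4 property asks for a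
  direct summand of the second component \<open>B\<close> of a decomposition of \<open>M\<close>.\<close>

lemma direct_decomposition_localize:
  assumes N: "submodule N R M" and D: "direct_decomposition R (restrict_module M N) A B"
  shows "direct_decomposition (localize_ring R p)
    (restrict_module (localize_module R p M) (localize_submodule R p M N))
    (localize_submodule R p M A) (localize_submodule R p M B)"
proof -
  interpret L: module "localize_ring R p" "localize_module R p M" by (rule module_localize_module)
  have A: "submodule A R M" "A \<subseteq> N" and B: "submodule B R M" "B \<subseteq> N"
    and sum: "A <+>\<^bsub>M\<^esub> B = N" and int: "A \<inter> B = {\<zero>\<^bsub>M\<^esub>}"
    using D submodule_restrict_iff[OF N]
    by (auto simp: direct_decomposition_def set_add_def')
  have "localize_submodule R p M {\<zero>\<^bsub>M\<^esub>} = {\<zero>\<^bsub>localize_module R p M\<^esub>}"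
    using fraction_zero one_S by (auto simp: localize_submodule_def)
  then have "localize_submodule R p M A \<inter> localize_submodule R p M B
      = {\<zero>\<^bsub>localize_module R p M\<^esub>}"
    using localize_submodule_Int[OF A(1) B(1)] int by simp
  moreover have "localize_submodule R p M A \<subseteq> localize_submodule R p M N"
    "localize_submodule R p M B \<subseteq> localize_submodule R p M N"
    using A(2) B(2) by (auto simp: localize_submodule_def)
  ultimately show ?thesis
    using L.submodule_restrict_iff[OF submodule_localize[OF N]] submodule_localize A(1) B(1)
      localize_submodule_add[OF A(1) B(1)] sum
    by (simp add: direct_decomposition_def set_add_def')
qed

section \<open>Localized homomorphisms\<close>

text \<open>This identifies the image of the localized map, so that the C4 property of \<open>M\<close>, which
  speaks about \<open>f ` A\<close>, can be localized.\<close>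

lemma localize_hom_image:
  assumes "submodule A R M" "submodule B R M"
    and "f \<in> module_hom R (restrict_module M A) (restrict_module M B)"
  shows "localize_hom R p M A f ` localize_submodule R p M A = localize_submodule R p M (f ` A)"
proof (intro equalityI subsetI)
  fix y assume "y \<in> localize_submodule R p M (f ` A)"
  then obtain a s where "y = frac (f a) s" "a \<in> A" "s \<in> S"
    by (auto simp: localize_submodule_def)
  then have "y = localize_hom R p M A f (frac a s)" "frac a s \<in> localize_submodule R p M A"
    using localize_hom_fraction[OF assms] by (auto simp: localize_submodule_def)
  then show "y \<in> localize_hom R p M A f ` localize_submodule R p M A" by blast
next
  fix y assume "y \<in> localize_hom R p M A f ` localize_submodule R p M A"
  then obtain a s where "y = localize_hom R p M A f (frac a s)" "a \<in> A" "s \<in> S"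
    by (auto simp: localize_submodule_def)
  then show "y \<in> localize_submodule R p M (f ` A)"
    using localize_hom_fraction[OF assms] by (simp add: localize_submoduleI)
qed

lemma localize_hom_in_module_hom:
  assumes A: "submodule A R M" and B: "submodule B R M"
    and f: "f \<in> module_hom R (restrict_module M A) (restrict_module M B)"
  shows "localize_hom R p M A f \<in> module_hom (localize_ring R p)
    (restrict_module (localize_module R p M) (localize_submodule R p M A))
    (restrict_module (localize_module R p M) (localize_submodule R p M B))"
proof -
  let ?Mp = "localize_module R p M" and ?F = "localize_hom R p M A f"
  note F = localize_hom_fraction[OF assms]
  have AM: "A \<subseteq> carrier M" and BM: "B \<subseteq> carrier M"
    using submoduleE(1)[OF A] submoduleE(1)[OF B] by auto
  have fB: "f x \<in> B" if "x \<in> A" for x using f that by (auto simp: module_hom_def)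
  have fa: "f (x \<oplus>\<^bsub>M\<^esub> y) = f x \<oplus>\<^bsub>M\<^esub> f y" if "x \<in> A" "y \<in> A" for x y
    using f that by (auto simp: module_hom_def)
  have fs: "f (r \<odot>\<^bsub>M\<^esub> x) = r \<odot>\<^bsub>M\<^esub> f x" if "r \<in> carrier R" "x \<in> A" for r x
    using f that by (auto simp: module_hom_def)
  have into: "?F x \<in> localize_submodule R p M B" if x: "x \<in> localize_submodule R p M A" for x
  proof -
    obtain a s where "x = frac a s" "a \<in> A" "s \<in> S"
      using x by (auto simp: localize_submodule_def)
    then show ?thesis using F fB by (simp add: localize_submoduleI)
  qed
  have add: "?F (x \<oplus>\<^bsub>?Mp\<^esub> y) = ?F x \<oplus>\<^bsub>?Mp\<^esub> ?F y"
    if xy: "x \<in> localize_submodule R p M A" "y \<in> localize_submodule R p M A" for x y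
  proof -
    obtain a s b t where x: "x = frac a s" "a \<in> A" "s \<in> S" and y: "y = frac b t" "b \<in> A" "t \<in> S"
      using xy by (auto simp: localize_submodule_def)
    have tasb: "t \<odot>\<^bsub>M\<^esub> a \<in> A" "s \<odot>\<^bsub>M\<^esub> b \<in> A" using x y submoduleE(4)[OF A] by auto
    have c: "a \<in> carrier M" "b \<in> carrier M" "f a \<in> carrier M" "f b \<in> carrier M"
      using x y AM BM fB by auto
    have "?F (x \<oplus>\<^bsub>?Mp\<^esub> y) = ?F (frac (t \<odot>\<^bsub>M\<^esub> a \<oplus>\<^bsub>M\<^esub> s \<odot>\<^bsub>M\<^esub> b) (s \<otimes> t))"
      using x y c by (simp add: localize_module_simps)
    also have "\<dots> = frac (t \<odot>\<^bsub>M\<^esub> f a \<oplus>\<^bsub>M\<^esub> s \<odot>\<^bsub>M\<^esub> f b) (s \<otimes> t)"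
      using F[OF submoduleE(5)[OF A tasb] mult_S[OF x(3) y(3)]] fa[OF tasb] fs x y by simp
    also have "\<dots> = ?F x \<oplus>\<^bsub>?Mp\<^esub> ?F y"
      using x y c F by (simp add: localize_module_simps)
    finally show ?thesis .
  qed
  have smult: "?F (r \<odot>\<^bsub>?Mp\<^esub> x) = r \<odot>\<^bsub>?Mp\<^esub> ?F x"
    if rx: "r \<in> carrier (localize_ring R p)" "x \<in> localize_submodule R p M A" for r x
  proof -
    obtain c s a t where r: "r = fraction R p (regular_module R) c s" "c \<in> carrier R" "s \<in> S"
      and x: "x = frac a t" "a \<in> A" "t \<in> S"
      using rx by (auto simp: carrier_localize_ring localize_submodule_def)
    have c: "a \<in> carrier M" "f a \<in> carrier M" using x AM BM fB by auto
    show ?thesis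
      using r x c F F[OF submoduleE(4)[OF A r(2) x(2)] mult_S[OF r(3) x(3)]] fs
      by (simp add: localize_module_simps)
  qed
  show ?thesis using into add smult by (auto simp: module_hom_def)
qed

text \<open>If \<open>f a/s = f b/t\<close>, then \<open>f (uta) = f (usb)\<close> for some \<open>u\<close> outside \<open>p\<close>, by linearity of \<open>f\<close>;
  injectivity of \<open>f\<close> gives \<open>uta = usb\<close>, that is \<open>a/s = b/t\<close>.\<close>

lemma inj_on_localize_hom:
  assumes A: "submodule A R M" and B: "submodule B R M"
    and f: "f \<in> module_hom R (restrict_module M A) (restrict_module M B)"
    and inj: "inj_on f A"
  shows "inj_on (localize_hom R p M A f) (localize_submodule R p M A)"
proof (rule inj_onI)
  fix x y
  assume xy: "x \<in> localize_submodule R p M A" "y \<in> localize_submodule R p M A"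
    and eq: "localize_hom R p M A f x = localize_hom R p M A f y"
  obtain a s b t where x: "x = frac a s" "a \<in> A" "s \<in> S" and y: "y = frac b t" "b \<in> A" "t \<in> S"
    using xy by (auto simp: localize_submodule_def)
  have fB: "f z \<in> B" if "z \<in> A" for z using f that by (auto simp: module_hom_def)
  have fs: "f (r \<odot>\<^bsub>M\<^esub> z) = r \<odot>\<^bsub>M\<^esub> f z" if "r \<in> carrier R" "z \<in> A" for r z
    using f that by (auto simp: module_hom_def)
  have c: "a \<in> carrier M" "b \<in> carrier M" "f a \<in> carrier M" "f b \<in> carrier M"
    using x y fB submoduleE(1)[OF A] submoduleE(1)[OF B] by auto
  have "frac (f a) s = frac (f b) t"
    using eq x y localize_hom_fraction[OF A B f] by simp
  then obtain u where u: "u \<in> S" "u \<odot>\<^bsub>M\<^esub> (t \<odot>\<^bsub>M\<^esub> f a) = u \<odot>\<^bsub>M\<^esub> (s \<odot>\<^bsub>M\<^esub> f b)"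
    using fraction_eq_iff[OF c(3,4) x(3) y(3)] by blast
  have mem: "t \<odot>\<^bsub>M\<^esub> a \<in> A" "s \<odot>\<^bsub>M\<^esub> b \<in> A"
    "u \<odot>\<^bsub>M\<^esub> (t \<odot>\<^bsub>M\<^esub> a) \<in> A" "u \<odot>\<^bsub>M\<^esub> (s \<odot>\<^bsub>M\<^esub> b) \<in> A"
    using x y u(1) submoduleE(4)[OF A] by auto
  have "f (u \<odot>\<^bsub>M\<^esub> (t \<odot>\<^bsub>M\<^esub> a)) = f (u \<odot>\<^bsub>M\<^esub> (s \<odot>\<^bsub>M\<^esub> b))"
    using u fs x y mem by simp
  then have "u \<odot>\<^bsub>M\<^esub> (t \<odot>\<^bsub>M\<^esub> a) = u \<odot>\<^bsub>M\<^esub> (s \<odot>\<^bsub>M\<^esub> b)"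
    using inj mem by (simp add: inj_on_eq_iff)
  then show "x = y"
    using fraction_eq_iff[OF c(1,2) x(3) y(3)] u(1) x(1) y(1) by blast
qed

lemma module_isomorphic_localize:
  assumes A: "submodule A R M" and B: "submodule B R M"
    and iso: "module_isomorphic R (restrict_module M A) (restrict_module M B)"
  shows "module_isomorphic (localize_ring R p)
    (restrict_module (localize_module R p M) (localize_submodule R p M A))
    (restrict_module (localize_module R p M) (localize_submodule R p M B))"
proof -
  obtain h where h: "h \<in> module_hom R (restrict_module M A) (restrict_module M B)"
    and bij: "inj_on h A" "h ` A = B"
    using iso by (auto simp: module_isomorphic_def bij_betw_def)
  have "bij_betw (localize_hom R p M A h) (localize_submodule R p M A) (localize_submodule R p M B)"
    using inj_on_localize_hom[OF A B h bij(1)] localize_hom_image[OF A B h] bij(2)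
    by (simp add: bij_betw_def)
  then show ?thesis
    using localize_hom_in_module_hom[OF A B h] by (auto simp: module_isomorphic_def)
qed

end

section \<open>The C4 property of the localization\<close>

theorem theorem3p4:
  fixes R :: "('r, 'c) ring_scheme" and M :: "('r, 'm, 'd) module_scheme" and p :: "'r set"
  assumes "cring R"
    and "C4_module R M"
    and "primeideal p R"
    and "decomposition_lifting R p M"
    and "morphism_lifting R p M"
  shows "C4_module (localize_ring R p) (localize_module R p M)"
proof -
  have "module R M" using assms(2) by (simp add: C4_module_def)
  then interpret localization R M p using assms(3) by (rule localization.intro)
  let ?Rp = "localize_ring R p" and ?Mp = "localize_module R p M"
  show ?thesis
    unfolding C4_module_def
  proof (intro conjI allI impI)
    show "module ?Rp ?Mp" by (rule module_localize_module)
    fix U V g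
    assume UV: "direct_decomposition ?Rp ?Mp U V"
      and g: "g \<in> module_hom ?Rp (restrict_module ?Mp U) (restrict_module ?Mp V)"
    obtain A B where AB: "direct_decomposition R M A B"
      and U: "U = localize_submodule R p M A" and V: "V = localize_submodule R p M B"
      using assms(4) UV unfolding decomposition_lifting_def by blast
    have A: "submodule A R M" and B: "submodule B R M"
      using AB by (auto simp: direct_decomposition_def)
    obtain f where f: "f \<in> module_hom R (restrict_module M A) (restrict_module M B)"
      and gf: "\<forall>X \<in> U. g X = localize_hom R p M A f X"
      using assms(5) AB g unfolding morphism_lifting_def U V by blast
    obtain D E where DE: "direct_decomposition R (restrict_module M B) D E"
      and iso: "module_isomorphic R (restrict_module M (f ` A)) (restrict_module M D)"
      using assms(2) AB f unfolding C4_module_def direct_summand_def by blast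
    have D: "submodule D R M"
      using DE submodule_restrict_iff[OF B] by (simp add: direct_decomposition_def)
    have "g ` U = localize_submodule R p M (f ` A)"
      using gf localize_hom_image[OF A B f] U by (metis image_cong)
    then have "module_isomorphic ?Rp (restrict_module ?Mp (g ` U))
        (restrict_module ?Mp (localize_submodule R p M D))"
      using module_isomorphic_localize[OF image_submodule[OF A B f] D iso] by simp
    moreover have "direct_summand ?Rp (restrict_module ?Mp V) (localize_submodule R p M D)"
      using direct_decomposition_localize[OF B DE] V unfolding direct_summand_def by blast
    ultimately show "\<exists>D. direct_summand ?Rp (restrict_module ?Mp V) D \<and>
        module_isomorphic ?Rp (restrict_module ?Mp (g ` U)) (restrict_module ?Mp D)"
      by blast
  qed
qed

end
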